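(* Let $N\ge1$, $p\ge0$, $k_1,k_2$ be integers with $p<k_1\leqslant k_2<N$, and let $x^{k_1}\in L_{k_1}$, $x^{k_2}\in L_{k_2}$. If a monotone Boolean function $f:\{0,1\}^N\to\{0,1\}$ is ideal with respect to $x^{k_1}$ and $x^{k_2}$, then $$2^N\hat f(\mathcal S_{11})=\binom{N-1}{p}-\binom{k_1-1}{p}-\binom{k_2-1}{p},$$ $$2^N\hat f(\mathcal S_{10})=\binom{N-1}{p}+\sum_{l=p+1}^{k_2}\binom{k_2}{l}-\binom{k_1-1}{p},$$ $$2^N\hat f(\mathcal S_{01})=\binom{N-1}{p}+\sum_{l=p+1}^{k_1}\binom{k_1}{l}-\binom{k_2-1}{p},$$ $$2^N\hat f(\mathcal S_{00})=\binom{N-1}{p}+\sum_{l=p+1}^{k_1}\binom{k_1}{l}+\sum_{l=p+1}^{k_2}\binom{k_2}{l},$$ where $\hat f(\mathcal S_\bullet)$ denotes the influence $\hat f(j)$ of any $j\in\mathcal S_\bullet$ (each formula is asserted for every $j$ in the corresponding set, and there is no assertion when that set is empty).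
   Context: $\{0,1\}^N$ carries the componentwise partial order; $f:\{0,1\}^N\to\{0,1\}$ is monotone if $x\le y$ implies $f(x)\le f(y)$. $\|x\|_1$ is the number of ones in $x$; $L_k=\{x\in\{0,1\}^N:\|x\|_1=k\}$ and $L_{\leqslant k}=\{x:\|x\|_1\leqslant k\}$. For $x\in L_k$ with $k>p$, the Boolean sub-cube $\mathcal B_{x}$ determined by $x$ is the set of all $y\le x$ with $p+1\le\|y\|_1\le k$. $\Delta$ is the Hamming distance, $\Delta(x,y)=\#\{i:x_i\neq y_i\}$, and for sets $\Delta(A,B)=\min_{a\in A,b\in B}\Delta(a,b)$. An upper zero of $f$ is a point $x$ with $f(x)=0$ and $f(y)=1$ for every $y>x$. Two-structure ideal: let $x^{k_1}\in L_{k_1}$ and $x^{k_2}\in L_{k_2}$ be two upper zeros of a monotone Boolean function $f$, with $p<k_1\le k_2<N$. Then $f$ is called ideal with respect to $x^{k_1}$ and $x^{k_2}$ if (1) $\Delta(\mathcal B_{x^{k_1}}\setminus L_{\leqslant p},\ \mathcal B_{x^{k_2}}\setminus L_{\leqslant p})>0$ (i.e. the two sub-cubes are disjoint above level $p$), and (2) $f(x)=0$ for all $x\in\mathcal B_{x^{k_1}}\cup\mathcal B_{x^{k_2}}\cup L_{\leqslant p}$ and $f(x)=1$ for all other $x$. For $i=1,2$ and $j=0,1$ put $\mathcal S^{j}_{x^{k_i}}=\{l\in\{1,\dots,N\}:x^{k_i}_l=j\}$, and $\mathcal S_{ab}=\mathcal S^{a}_{x^{k_1}}\cap\mathcal S^{b}_{x^{k_2}}$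 for $a,b\in\{0,1\}$. Influence: for $i\in\{1,\dots,N\}$, $\hat f(i)=2^{-N}\sum_{x\in\{0,1\}^N}f(x)(-1)^{1+x_i}$. For monotone $f$, $2^N\hat f(i)$ is the number of $x\in\{0,1\}^N$ with $x_i=0$, $f(x)=0$ and $f(x+e_i)=1$, where $x+e_i$ is $x$ with the $i$-th bit changed to $1$. Binomial coefficients $\binom{a}{b}$ are $0$ if $b>a$. *)

theory Defs
  imports Complex_Main "HOL-Library.FuncSet"
begin

text \<open>
  Points of the cube are extensional functions, so each point has exactly one representative and,
  for points of the cube, the library order on functions is the componentwise order.
\<close>

definition cube :: "nat \<Rightarrow> (nat \<Rightarrow> nat) set" where
  "cube N = {1..N} \<rightarrow>\<^sub>E {0, 1}"

definition boolean_function :: "nat \<Rightarrow> ((nat \<Rightarrow> nat) \<Rightarrow> nat) \<Rightarrow> bool" where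
  "boolean_function N f \<longleftrightarrow> f \<in> cube N \<rightarrow> {0, 1}"

definition norm1 :: "nat \<Rightarrow> (nat \<Rightarrow> nat) \<Rightarrow> nat" where
  "norm1 N x = (\<Sum>i = 1..N. x i)"

definition layer :: "nat \<Rightarrow> nat \<Rightarrow> (nat \<Rightarrow> nat) set" where
  "layer N k = {x \<in> cube N. norm1 N x = k}"

definition layers_upto :: "nat \<Rightarrow> nat \<Rightarrow> (nat \<Rightarrow> nat) set" where
  "layers_upto N k = {x \<in> cube N. norm1 N x \<le> k}"

definition subcube :: "nat \<Rightarrow> nat \<Rightarrow> (nat \<Rightarrow> nat) \<Rightarrow> (nat \<Rightarrow> nat) set" where
  "subcube N p x = {y \<in> cube N. y \<le> x \<and> p + 1 \<le> norm1 N y \<and> norm1 N y \<le> norm1 N x}"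

definition hamming :: "nat \<Rightarrow> (nat \<Rightarrow> nat) \<Rightarrow> (nat \<Rightarrow> nat) \<Rightarrow> nat" where
  "hamming N x y = card {i \<in> {1..N}. x i \<noteq> y i}"

text \<open>Only meaningful for nonempty subsets of the cube; these are automatically finite.\<close>

definition hamming_set :: "nat \<Rightarrow> (nat \<Rightarrow> nat) set \<Rightarrow> (nat \<Rightarrow> nat) set \<Rightarrow> nat" where
  "hamming_set N A B = Min ((\<lambda>(a, b). hamming N a b) ` (A \<times> B))"

definition upper_zero :: "nat \<Rightarrow> ((nat \<Rightarrow> nat) \<Rightarrow> nat) \<Rightarrow> (nat \<Rightarrow> nat) \<Rightarrow> bool" where
  "upper_zero N f x \<longleftrightarrow> x \<in> cube N \<and> f x = 0 \<and> (\<forall>y \<in> cube N. x < y \<longrightarrow> f y = 1)"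

text \<open>
  To be used for monotone Boolean functions \<open>f\<close> and points \<open>x1\<close>, \<open>x2\<close> with
  \<open>p < norm1 N x1 \<le> norm1 N x2 < N\<close>.
\<close>

definition ideal2 ::
    "nat \<Rightarrow> nat \<Rightarrow> ((nat \<Rightarrow> nat) \<Rightarrow> nat) \<Rightarrow> (nat \<Rightarrow> nat) \<Rightarrow> (nat \<Rightarrow> nat) \<Rightarrow> bool" where
  "ideal2 N p f x1 x2 \<longleftrightarrow>
     upper_zero N f x1 \<and> upper_zero N f x2 \<and>
     hamming_set N (subcube N p x1 - layers_upto N p) (subcube N p x2 - layers_upto N p) > 0 \<and>
     (\<forall>x \<in> subcube N p x1 \<union> subcube N p x2 \<union> layers_upto N p. f x = 0) \<and>
     (\<forall>x \<in> cube N - (subcube N p x1 \<union> subcube N p x2 \<union> layers_upto N p). f x = 1)"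

definition bit_set :: "nat \<Rightarrow> nat \<Rightarrow> (nat \<Rightarrow> nat) \<Rightarrow> nat set" where
  "bit_set N b x = {l \<in> {1..N}. x l = b}"

definition bit_class ::
    "nat \<Rightarrow> (nat \<Rightarrow> nat) \<Rightarrow> (nat \<Rightarrow> nat) \<Rightarrow> nat \<Rightarrow> nat \<Rightarrow> nat set" where
  "bit_class N x1 x2 a b = bit_set N a x1 \<inter> bit_set N b x2"

definition influence :: "nat \<Rightarrow> ((nat \<Rightarrow> nat) \<Rightarrow> nat) \<Rightarrow> nat \<Rightarrow> real" where
  "influence N f i = (\<Sum>x \<in> cube N. real (f x) * (- 1) ^ (1 + x i)) / 2 ^ N"

end

theory Submission
  imports Defs
begin

text \<open>
  The signs \<open>(- 1) ^ (1 + x j)\<close> cancel over the whole cube, so the scaled influence is the sum of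
  \<open>(- 1) ^ x j\<close> over the zeros of \<open>f\<close>, a disjoint union of \<open>L\<^bsub>\<le>p\<^esub>\<close> and the two sub-cubes.
  Identifying points with sets, the sum of \<open>(- 1) ^ [j \<in> A]\<close> over the sets \<open>A \<subseteq> T\<close> of size at most
  \<open>p\<close> telescopes: pairing \<open>A\<close> with \<open>insert j A\<close> leaves only the \<open>(card T - 1) choose p\<close> sets of
  size exactly \<open>p\<close> that avoid \<open>j\<close>. On a sub-cube whose top vanishes at \<open>j\<close>, all signs are \<open>+1\<close>.
\<close>

lemma sum_sign_subsets_card_le:
  fixes j :: 'a
  assumes "finite T" "j \<in> T"
  shows "(\<Sum>A | A \<subseteq> T \<and> card A \<le> p. (- 1) ^ of_bool (j \<in> A)) = real ((card T - 1) choose p)"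
proof -
  let ?T = "T - {j}"
  let ?E = "{A. A \<subseteq> ?T \<and> card A = p}"
  \<comment> \<open>The strict bound leaves room for \<open>j\<close>: \<open>insert j\<close> adds
    one element, so the images have size at most \<open>p\<close>, and every \<open>A\<close> with
    \<open>j \<in> A\<close> arises this way from \<open>A - {j}\<close>.\<close>
  let ?L = "{A. A \<subseteq> ?T \<and> card A < p}"
  have fin: "finite A" "j \<notin> A" if "A \<subseteq> ?T" for A
    using that assms by (auto dest: finite_subset)
  have finE: "finite ?E" and finL: "finite ?L"
    using assms by simp_all
  have split: "{A. A \<subseteq> T \<and> card A \<le> p} = ?E \<union> ?L \<union> insert j ` ?L"
  proof (intro equalityI subsetI)
    fix A assume A: "A \<in> {A. A \<subseteq> T \<and> card A \<le> p}"
    show "A \<in> ?E \<union> ?L \<union> insert j ` ?L"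
    proof (cases "j \<in> A")
      case True
      have "finite A" using A assms by (auto dest: finite_subset)
      then have "card (A - {j}) < card A" using True by (rule card_Diff1_less)
      then have "A - {j} \<in> ?L" using A by auto
      moreover have "A = insert j (A - {j})" using True by auto
      ultimately show ?thesis by blast
    qed (use A in auto)
  next
    fix A assume "A \<in> ?E \<union> ?L \<union> insert j ` ?L"
    then consider "A \<in> ?E \<union> ?L" | B where "A = insert j B" "B \<in> ?L" by blast
    then show "A \<in> {A. A \<subseteq> T \<and> card A \<le> p}"
    proof cases
      case 2
      with fin[of B] assms show ?thesis by auto
    qed auto
  qed
  have disj: "?E \<inter> ?L = {}" "(?E \<union> ?L) \<inter> insert j ` ?L = {}"
    using fin(2) by blast+
  have inj: "inj_on (insert j) ?L"
  proof (rule inj_onI)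
    fix A B assume "A \<in> ?L" "B \<in> ?L" and eq: "insert j A = insert j B"
    then have "j \<notin> A" "j \<notin> B" by auto
    with eq show "A = B" by (simp add: insert_ident)
  qed
  have "(\<Sum>A | A \<subseteq> T \<and> card A \<le> p. (- 1) ^ of_bool (j \<in> A)) =
    (\<Sum>A\<in>?E. (- 1) ^ of_bool (j \<in> A)) + (\<Sum>A\<in>?L. (- 1) ^ of_bool (j \<in> A))
      + (\<Sum>A\<in>insert j ` ?L. (- 1 :: real) ^ of_bool (j \<in> A))"
    unfolding split using finE finL disj by (simp only: sum.union_disjoint finite_UnI finite_imageI)
  also have "\<dots> = (\<Sum>A\<in>?E. 1) + (\<Sum>A\<in>?L. 1) + (\<Sum>A\<in>?L. - 1)"
    unfolding sum.reindex[OF inj] o_def by (intro arg_cong2[where f = "(+)"] sum.cong) (simp_all add: fin)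
  also have "\<dots> = real (card ?E)"
    by simp
  also have "card ?E = (card T - 1) choose p"
    using n_subsets[of ?T p] assms by simp
  finally show ?thesis .
qed

text \<open>The signs cancel over all subsets of \<open>T\<close>, which is the preceding lemma at
  the bound \<open>card T\<close>. The large sets therefore contribute the negative of what the
  small ones do.\<close>

lemma sum_sign_subsets_card_gt:
  fixes j :: 'a
  assumes "finite T" "j \<in> T"
  shows "(\<Sum>A | A \<subseteq> T \<and> p < card A. (- 1) ^ of_bool (j \<in> A)) = - real ((card T - 1) choose p)"
proof -
  let ?s = "\<lambda>A. (- 1 :: real) ^ of_bool (j \<in> A)"
  let ?lo = "{A. A \<subseteq> T \<and> card A \<le> p}" and ?hi = "{A. A \<subseteq> T \<and> p < card A}"
  \<comment> \<open>Natural subtraction truncates, so \<open>card T > 0\<close> matters here;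
    \<open>j \<in> T\<close> provides it. The inequality makes
    \<open>(card T - 1) choose card T\<close> vanish.\<close>
  have "card T - 1 < card T"
    using assms by (metis card_gt_0_iff diff_less empty_iff less_one)
  moreover have "?lo \<union> ?hi = {A. A \<subseteq> T \<and> card A \<le> card T}"
    using assms by (auto simp: card_mono)
  ultimately have "sum ?s (?lo \<union> ?hi) = 0"
    using sum_sign_subsets_card_le[OF assms, of "card T"] by (simp add: binomial_eq_0)
  moreover have "sum ?s (?lo \<union> ?hi) = sum ?s ?lo + sum ?s ?hi"
    using assms by (intro sum.union_disjoint) auto
  ultimately show ?thesis
    using sum_sign_subsets_card_le[OF assms, of p] by simp
qed

lemma card_subsets_card_gt:
  assumes "finite T"
  shows "card {A. A \<subseteq> T \<and> p < card A} = (\<Sum>l = p + 1..card T. card T choose l)"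
proof -
  have "{A. A \<subseteq> T \<and> p < card A} = (\<Union>l\<in>{p + 1..card T}. {A. A \<subseteq> T \<and> card A = l})"
    using assms by (auto simp: card_mono)
  also have "card \<dots> = (\<Sum>l = p + 1..card T. card {A. A \<subseteq> T \<and> card A = l})"
    using assms by (intro card_UN_disjoint) auto
  finally show ?thesis
    using assms by (simp add: n_subsets)
qed

text \<open>The indicator function of \<open>A\<close>, restricted to \<open>{1..N}\<close> so that
  it is extensional and hence a point of \<open>cube N\<close>. On \<open>cube N\<close>,
  \<open>bit_set N 1\<close> recovers the set from the point.\<close>

definition cube_point :: "nat \<Rightarrow> nat set \<Rightarrow> nat \<Rightarrow> nat" where
  "cube_point N A = (\<lambda>l\<in>{1..N}. of_bool (l \<in> A))"

lemma cube_point_apply [simp]: "l \<in> {1..N} \<Longrightarrow> cube_point N A l = of_bool (l \<in> A)"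
  by (simp add: cube_point_def)

lemma inj_on_cube_point: "inj_on (cube_point N) (Pow {1..N})"
proof (rule inj_onI)
  fix A B assume AB: "A \<in> Pow {1..N}" "B \<in> Pow {1..N}" and eq: "cube_point N A = cube_point N B"
  have "l \<in> A \<longleftrightarrow> l \<in> B" if "l \<in> {1..N}" for l
    using fun_cong[OF eq, of l] that by (simp add: of_bool_eq_iff)
  with AB show "A = B" by blast
qed

lemma cube_point_in_cube: "cube_point N A \<in> cube N"
  by (auto simp: cube_point_def cube_def)

lemma cube_point_bit_set: "x \<in> cube N \<Longrightarrow> cube_point N (bit_set N 1 x) = x"
  by (auto simp: cube_point_def cube_def bit_set_def PiE_iff extensional_def fun_eq_iff)

lemma bit_set_subset: "bit_set N b x \<subseteq> {1..N}"
  by (auto simp: bit_set_def)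

lemma cube_eq_image: "cube N = cube_point N ` Pow {1..N}"
proof (intro equalityI subsetI)
  fix x assume "x \<in> cube N"
  then show "x \<in> cube_point N ` Pow {1..N}"
    using cube_point_bit_set[of x N] bit_set_subset[of N 1 x] by (metis PowI image_eqI)
qed (use cube_point_in_cube in blast)

lemma norm1_cube_point: "A \<subseteq> {1..N} \<Longrightarrow> norm1 N (cube_point N A) = card A"
  by (simp add: norm1_def Int_absorb1)

text \<open>Outside \<open>{1..N}\<close> both functions take the same value
  \<open>undefined\<close>, so only the coordinates in \<open>{1..N}\<close> decide the
  order.\<close>

lemma cube_point_le_iff:
  assumes "A \<subseteq> {1..N}"
  shows "cube_point N A \<le> cube_point N B \<longleftrightarrow> A \<subseteq> B"
  using assms by (auto simp: le_fun_def cube_point_def split: if_splits)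

lemma layers_upto_eq_image:
  "layers_upto N p = cube_point N ` {A. A \<subseteq> {1..N} \<and> card A \<le> p}"
  by (auto simp: layers_upto_def cube_eq_image norm1_cube_point)

lemma subcube_cube_point:
  assumes "T \<subseteq> {1..N}"
  shows "subcube N p (cube_point N T) = cube_point N ` {A. A \<subseteq> T \<and> p < card A}"
proof -
  have "finite T" using assms finite_subset by blast
  with assms show ?thesis
    by (auto simp: subcube_def cube_eq_image norm1_cube_point cube_point_le_iff card_mono)
qed

lemma sum_cube_point:
  assumes "F \<subseteq> Pow {1..N}" "j \<in> {1..N}"
  shows "(\<Sum>x\<in>cube_point N ` F. (- 1) ^ x j) = (\<Sum>A\<in>F. (- 1 :: real) ^ of_bool (j \<in> A))"
  using assms by (subst sum.reindex) (auto simp del: atLeastAtMost_iff One_nat_def intro: inj_on_subset[OF inj_on_cube_point])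

lemma sum_sign_layers_upto:
  assumes "j \<in> {1..N}"
  shows "(\<Sum>x\<in>layers_upto N p. (- 1) ^ x j) = real ((N - 1) choose p)"
proof -
  have "{A. A \<subseteq> {1..N} \<and> card A \<le> p} \<subseteq> Pow {1..N}" by blast
  from sum_cube_point[OF this assms] show ?thesis
    using sum_sign_subsets_card_le[of "{1..N}" j p] assms by (simp add: layers_upto_eq_image)
qed

text \<open>With \<open>T\<close> the support of \<open>x\<close>, the sum runs over the subsets of
  \<open>T\<close> with more than \<open>p\<close> elements. For \<open>j\<close> outside
  \<open>T\<close> it merely counts them, by size; for \<open>j\<close> in \<open>T\<close> the
  cancellation for large sets applies.\<close>

lemma sum_sign_subcube:
  assumes "x \<in> layer N k" "j \<in> {1..N}"
  shows "(\<Sum>y\<in>subcube N p x. (- 1) ^ y j) =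
    (if x j = 0 then \<Sum>l = p + 1..k. real (k choose l) else - real ((k - 1) choose p))"
proof -
  define T where "T = bit_set N 1 x"
  have T: "T \<subseteq> {1..N}" "finite T" and x: "x = cube_point N T"
    using assms(1) bit_set_subset finite_subset[OF bit_set_subset]
    by (auto simp only: T_def layer_def cube_point_bit_set finite_atLeastAtMost mem_Collect_eq)
  have k: "card T = k"
    using assms(1) norm1_cube_point[OF T(1)] by (simp add: x layer_def)
  have xj: "x j = 0 \<longleftrightarrow> j \<notin> T"
    using assms(2) by (simp add: x)
  have "{A. A \<subseteq> T \<and> p < card A} \<subseteq> Pow {1..N}" using T by blast
  from sum_cube_point[OF this assms(2)]
  have sum_eq: "(\<Sum>y\<in>subcube N p x. (- 1) ^ y j) =
      (\<Sum>A | A \<subseteq> T \<and> p < card A. (- 1 :: real) ^ of_bool (j \<in> A))"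
    by (simp add: x subcube_cube_point[OF T(1)])
  show ?thesis
  proof (cases "j \<in> T")
    case True
    then show ?thesis
      using sum_sign_subsets_card_gt[OF T(2) True, of p] by (simp add: sum_eq xj k)
  next
    case False
    then have "(\<Sum>A | A \<subseteq> T \<and> p < card A. (- 1 :: real) ^ of_bool (j \<in> A)) =
        (\<Sum>A | A \<subseteq> T \<and> p < card A. 1)"
      by (intro sum.cong) auto
    with False show ?thesis
      using card_subsets_card_gt[OF T(2), of p] by (simp add: sum_eq xj k)
  qed
qed

lemma finite_cube: "finite (cube N)"
  by (simp add: cube_eq_image)

lemma subcube_subset: "subcube N p x \<subseteq> cube N"
  by (auto simp: subcube_def)

lemma layers_upto_subset: "layers_upto N p \<subseteq> cube N"
  by (auto simp: layers_upto_def)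

lemma sum_sign_cube:
  assumes "j \<in> {1..N}"
  shows "(\<Sum>x\<in>cube N. (- 1) ^ x j) = (0 :: real)"
proof -
  \<comment> \<open>The whole cube is the case \<open>p = N\<close> of the low layers, where the
    value \<open>(N - 1) choose N\<close> is zero because \<open>j \<in> {1..N}\<close> forces
    \<open>N\<close> to be positive.\<close>
  have "cube N = layers_upto N N"
    using card_mono[of "{1..N}"] by (auto simp: layers_upto_eq_image cube_eq_image)
  then show ?thesis
    using sum_sign_layers_upto[OF assms, of N] assms by (simp add: binomial_eq_0)
qed

text \<open>A common point has distance 0 to itself, which would bring the minimum down to 0.
  Finiteness makes \<open>Min\<close> a lower bound.\<close>

lemma disjoint_if_hamming_set_pos:
  assumes "finite A" "finite B" "hamming_set N A B > 0"
  shows "A \<inter> B = {}"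
proof (rule ccontr)
  assume "A \<inter> B \<noteq> {}"
  then obtain z where "z \<in> A" "z \<in> B" by blast
  then have "hamming N z z \<in> (\<lambda>(a, b). hamming N a b) ` (A \<times> B)" by force
  then have "hamming_set N A B \<le> hamming N z z"
    unfolding hamming_set_def using assms by (intro Min_le) auto
  then show False using assms(3) by (simp add: hamming_def)
qed

lemma scaled_influence_eq_sum_zeros:
  assumes "j \<in> {1..N}" "Z \<subseteq> cube N" "\<forall>x\<in>Z. f x = 0" "\<forall>x\<in>cube N - Z. f x = 1"
  shows "2 ^ N * influence N f j = (\<Sum>x\<in>Z. (- 1) ^ x j)"
proof -
  \<comment> \<open>The summand 1 in the exponent \<open>1 + x j\<close> gives the leading minus
    sign. It disappears again at the end, when the sum over the complement of \<open>Z\<close>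
    becomes minus the sum over \<open>Z\<close>.\<close>
  have "2 ^ N * influence N f j = - (\<Sum>x\<in>cube N. real (f x) * (- 1) ^ x j)"
    by (simp add: influence_def sum_negf)
  also have "\<dots> = - (\<Sum>x\<in>cube N - Z. (- 1) ^ x j)"
    using assms by (subst sum.subset_diff[OF assms(2) finite_cube]) simp
  also have "\<dots> = (\<Sum>x\<in>Z. (- 1) ^ x j)"
    using sum.subset_diff[OF assms(2) finite_cube, of "\<lambda>x. (- 1 :: real) ^ x j"]
      sum_sign_cube[OF assms(1)] by simp
  finally show ?thesis .
qed

text \<open>Keeping \<open>x1 j\<close> and \<open>x2 j\<close> open treats the four bit classes at
  once: the three disjoint pieces of the zero set contribute one term each, and each sub-cube term
  depends only on its own top.\<close>

lemma scaled_influence_ideal2: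
  assumes "ideal2 N p f x1 x2" "x1 \<in> layer N k1" "x2 \<in> layer N k2" "j \<in> {1..N}"
  shows "2 ^ N * influence N f j = real ((N - 1) choose p)
    + (if x1 j = 0 then \<Sum>l = p + 1..k1. real (k1 choose l) else - real ((k1 - 1) choose p))
    + (if x2 j = 0 then \<Sum>l = p + 1..k2. real (k2 choose l) else - real ((k2 - 1) choose p))"
proof -
  let ?L = "layers_upto N p" and ?B = "subcube N p"
  note fin = finite_subset[OF subcube_subset finite_cube] finite_subset[OF layers_upto_subset finite_cube]
  \<comment> \<open>Sub-cubes start at level \<open>p + 1\<close>, so removing \<open>?L\<close>
    leaves them unchanged, and the Hamming condition separates the sub-cubes themselves.\<close>
  have BL: "?B x \<inter> ?L = {}" for x
    by (auto simp: subcube_def layers_upto_def)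
  have "(?B x1 - ?L) \<inter> (?B x2 - ?L) = {}"
    using assms(1) fin by (intro disjoint_if_hamming_set_pos) (auto simp: ideal2_def)
  then have BB: "?B x1 \<inter> ?B x2 = {}"
    using BL by blast
  have "2 ^ N * influence N f j = (\<Sum>x\<in>?B x1 \<union> ?B x2 \<union> ?L. (- 1) ^ x j)"
    using assms(1,4) subcube_subset layers_upto_subset
    by (intro scaled_influence_eq_sum_zeros) (auto simp: ideal2_def)
  also have "\<dots> = (\<Sum>x\<in>?B x1. (- 1) ^ x j) + (\<Sum>x\<in>?B x2. (- 1) ^ x j) + (\<Sum>x\<in>?L. (- 1) ^ x j)"
    using fin BB BL by (simp add: sum.union_disjoint Int_Un_distrib2)
  finally show ?thesis
    using assms by (simp add: sum_sign_subcube sum_sign_layers_upto)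
qed

theorem theorem2:
  fixes N p k1 k2 :: nat
    and x1 x2 :: "nat \<Rightarrow> nat"
    and f :: "(nat \<Rightarrow> nat) \<Rightarrow> nat"
  assumes "N \<ge> 1"
    and "p < k1" and "k1 \<le> k2" and "k2 < N"
    and "x1 \<in> layer N k1" and "x2 \<in> layer N k2"
    and "boolean_function N f"
    and "mono_on (cube N) f"
    and "ideal2 N p f x1 x2"
  shows
    "(\<forall>j \<in> bit_class N x1 x2 1 1. 2 ^ N * influence N f j =
        real ((N - 1) choose p) - real ((k1 - 1) choose p) - real ((k2 - 1) choose p)) \<and>
     (\<forall>j \<in> bit_class N x1 x2 1 0. 2 ^ N * influence N f j =
        real ((N - 1) choose p) + (\<Sum>l = p + 1..k2. real (k2 choose l)) - real ((k1 - 1) choose p)) \<and>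
     (\<forall>j \<in> bit_class N x1 x2 0 1. 2 ^ N * influence N f j =
        real ((N - 1) choose p) + (\<Sum>l = p + 1..k1. real (k1 choose l)) - real ((k2 - 1) choose p)) \<and>
     (\<forall>j \<in> bit_class N x1 x2 0 0. 2 ^ N * influence N f j =
        real ((N - 1) choose p) + (\<Sum>l = p + 1..k1. real (k1 choose l))
          + (\<Sum>l = p + 1..k2. real (k2 choose l)))"
  \<comment> \<open>Membership in a bit class fixes \<open>x1 j\<close> and \<open>x2 j\<close>,
    which selects the branch of each conditional.\<close>
  using scaled_influence_ideal2[OF assms(9,5,6)]
  by (intro conjI ballI) (simp_all add: bit_class_def bit_set_def)

end
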